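(* For any uniform space $X$, the following statements are equivalent: (i) $X$ is a uniform D-space. (ii) $\mathbf{M}_\sigma(X) \subseteq \mathbf{M}_u(X)$.
   Context: All linear spaces are over $\mathbb{R}$. All uniform spaces are assumed Hausdorff and are described by their uniformly continuous pseudometrics (abbreviated u.c.p.). For a pseudometric $d$ on a set $X$, let $$\mathrm{Lip}(d) = \{ f : X \to \mathbb{R} \mid |f(x)| \le 1 \text{ and } |f(x)-f(x')| \le d(x,x') \text{ for all } x,x' \in X \},$$ considered with the topology of pointwise convergence on $X$ (as a subspace of $\mathbb{R}^X$). For a uniform space $X$, $\mathbf{U_b}(X)$ is the space of bounded uniformly continuous functions $f : X \to \mathbb{R}$ with the norm $\|f\| = \sup\{|f(x)| \mid x \in X\}$. $\mathbf{M}(X)$ is the norm dual of $\mathbf{U_b}(X)$. $\mathbf{Coz}(X)$ is the collection of all sets of the form $\{x \in X \mid f(x) \ne 0\}$ with $f \in \mathbf{U_b}(X)$, and $\sigma(\mathbf{Coz}(X))$ is the sigma-algebra of subsets of $X$ generated by $\mathbf{Coz}(X)$. $\mathbf{M}_u(X)$ (the space of uniform measures on $X$) is the space of those $\mu \in \mathbf{M}(X)$ whose restriction to $\mathrm{Lip}(d)$ is continuous (in the topology of pointwise convergence on $X$) for every u.c.p. $d$ on $X$. $\mathbf{M}_\sigma(X)$ is the space of those $\mu \in \mathbf{M}(X)$ for which there is a bounded (signed) countably additive measure $m$ on $\sigma(\mathbf{Coz}(X))$ such that $\mu(f) = \int f \, \mathrm{d}m$ for all $f \in \mathbf{U_b}(X)$.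 A cardinal number $\aleph$ has measure zero if, for a set $A$ of cardinality $\aleph$, $m(A) = 0$ for every non-negative finite (i.e. real-valued) countably additive measure $m$ defined on the sigma-algebra of all subsets of $A$ and such that $m(\{a\}) = 0$ for all $a \in A$. For a pseudometric $d$ on $X$, a set $Y \subseteq X$ is uniformly $d$-discrete if there is $\varepsilon > 0$ such that $d(y,y') \ge \varepsilon$ for all $y, y' \in Y$ with $y \ne y'$. A subset $Y$ of a uniform space $X$ is uniformly discrete if it is uniformly $d$-discrete for some u.c.p. $d$ on $X$. A uniform space $X$ is a (uniform) D-space if the cardinality of every uniformly discrete subset of $X$ has measure zero. *)

theory Defs
  imports "HOL-Analysis.Analysis"
begin

section \<open>Bounded uniformly continuous functions\<close>

lemma uniformly_continuous_on_UNIV_dist_iff: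
  fixes f :: "'a::uniform_space \<Rightarrow> 'b::metric_space"
  shows "uniformly_continuous_on UNIV f \<longleftrightarrow>
    (\<forall>e>0. eventually (\<lambda>(x, y). dist (f x) (f y) < e) uniformity)"
  by (simp add: uniformly_continuous_on_uniformity uniformity_dist filterlim_INF
      filterlim_principal case_prod_unfold Ball_def)

definition Ub :: "('a::uniform_space \<Rightarrow> real) set" where
  "Ub = {f. bounded (range f) \<and> uniformly_continuous_on UNIV f}"

lemma zero_in_Ub: "(\<lambda>_. 0) \<in> Ub"
  by (auto simp: Ub_def uniformly_continuous_on_UNIV_dist_iff image_def case_prod_unfold)

lemma add_in_Ub:
  assumes "f \<in> Ub" "g \<in> Ub"
  shows "(\<lambda>x. f x + g x) \<in> Ub"
proof -
  have "eventually (\<lambda>(x, y). dist (f x + g x) (f y + g y) < e) uniformity" if "e > 0" for e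
  proof -
    have "eventually (\<lambda>(x, y). dist (f x) (f y) < e / 2) uniformity"
      "eventually (\<lambda>(x, y). dist (g x) (g y) < e / 2) uniformity"
      using assms that half_gt_zero[OF that]
      unfolding Ub_def uniformly_continuous_on_UNIV_dist_iff by blast+
    then show ?thesis
    proof eventually_elim
      case (elim p)
      obtain x y where p: "p = (x, y)" by (cases p)
      have "\<bar>f x - f y\<bar> < e / 2" "\<bar>g x - g y\<bar> < e / 2"
        using elim p by (simp_all add: dist_real_def)
      then have "\<bar>(f x + g x) - (f y + g y)\<bar> < e" by linarith
      then show ?case
        using p by (simp add: dist_real_def)
    qed
  qed
  then show ?thesis
    using assms by (auto simp: Ub_def uniformly_continuous_on_UNIV_dist_iff bounded_plus_comp)
qed

lemma scaleR_in_Ub: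
  assumes "f \<in> Ub"
  shows "(\<lambda>x. c * f x) \<in> Ub"
proof -
  have "eventually (\<lambda>(x, y). dist (c * f x) (c * f y) < e) uniformity" if "e > 0" for e
  proof -
    have "eventually (\<lambda>(x, y). dist (f x) (f y) < e / (\<bar>c\<bar> + 1)) uniformity"
      using assms that unfolding Ub_def uniformly_continuous_on_UNIV_dist_iff
      by (simp add: add_nonneg_pos)
    then show ?thesis
    proof eventually_elim
      case (elim p)
      obtain x y where p: "p = (x, y)" by (cases p)
      have "(\<bar>c\<bar> + 1) * \<bar>f x - f y\<bar> < e"
        using elim p by (simp add: dist_real_def pos_less_divide_eq add_nonneg_pos mult.commute)
      moreover have "\<bar>c * f x - c * f y\<bar> = \<bar>c\<bar> * \<bar>f x - f y\<bar>"
        by (metis abs_mult right_diff_distrib)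
      ultimately show ?case
        using p by (simp add: dist_real_def distrib_right)
    qed
  qed
  moreover have "bounded (range (\<lambda>x. c * f x))"
    using assms bounded_scaleR_comp[of f UNIV c] by (simp add: Ub_def)
  ultimately show ?thesis
    by (auto simp: Ub_def uniformly_continuous_on_UNIV_dist_iff)
qed

typedef (overloaded) 'a ub = "Ub :: ('a::uniform_space \<Rightarrow> real) set"
  morphisms apply_ub Abs_ub
  using zero_in_Ub by blast

setup_lifting type_definition_ub

lemma bdd_above_Ub: "f \<in> Ub \<Longrightarrow> bdd_above (range (\<lambda>x. \<bar>f x\<bar>))"
  by (auto simp: Ub_def bounded_iff bdd_above_def)

instantiation ub :: (uniform_space) real_vector
begin

lift_definition zero_ub :: "'a ub" is "\<lambda>_. 0"
  by (rule zero_in_Ub)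

lift_definition plus_ub :: "'a ub \<Rightarrow> 'a ub \<Rightarrow> 'a ub" is "\<lambda>f g x. f x + g x"
  by (rule add_in_Ub)

lift_definition scaleR_ub :: "real \<Rightarrow> 'a ub \<Rightarrow> 'a ub" is "\<lambda>c f x. c * f x"
  by (rule scaleR_in_Ub)

lift_definition uminus_ub :: "'a ub \<Rightarrow> 'a ub" is "\<lambda>f x. - f x"
  using scaleR_in_Ub[of _ "-1"] by simp

lift_definition minus_ub :: "'a ub \<Rightarrow> 'a ub \<Rightarrow> 'a ub" is "\<lambda>f g x. f x - g x"
  using add_in_Ub[OF _ scaleR_in_Ub[of _ "-1"]] by simp

instance
proof
  fix f g h :: "'a ub" and a b :: real
  show "f + g + h = f + (g + h)" "f + g = g + f" "0 + f = f"
    "a *\<^sub>R (f + g) = a *\<^sub>R f + a *\<^sub>R g" "(a + b) *\<^sub>R f = a *\<^sub>R f + b *\<^sub>R f"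
    "a *\<^sub>R b *\<^sub>R f = (a * b) *\<^sub>R f" "1 *\<^sub>R f = f"
    by (transfer; simp add: algebra_simps)+
  show "- f + f = 0"
    by transfer simp
  show "f - g = f + - g"
    by transfer simp
qed

end

instantiation ub :: (uniform_space) real_normed_vector
begin

lift_definition norm_ub :: "'a ub \<Rightarrow> real" is "\<lambda>f. SUP x. \<bar>f x\<bar>" .

definition dist_ub :: "'a ub \<Rightarrow> 'a ub \<Rightarrow> real" where
  "dist_ub f g = norm (f - g)"

definition sgn_ub :: "'a ub \<Rightarrow> 'a ub" where
  "sgn_ub f = f /\<^sub>R norm f"

definition uniformity_ub :: "('a ub \<times> 'a ub) filter" where
  "uniformity_ub = (INF e\<in>{0<..}. principal {(f, g). dist f g < e})"

definition open_ub :: "'a ub set \<Rightarrow> bool" where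
  "open_ub S \<longleftrightarrow> (\<forall>f\<in>S. \<forall>\<^sub>F (f', g) in uniformity. f' = f \<longrightarrow> g \<in> S)"

instance
proof
  fix f g :: "'a ub" and a :: real
  show "dist f g = norm (f - g)"
    by (rule dist_ub_def)
  show "sgn f = f /\<^sub>R norm f"
    by (rule sgn_ub_def)
  show "(uniformity :: ('a ub \<times> 'a ub) filter) = (INF e\<in>{0<..}. principal {(x, y). dist x y < e})"
    by (rule uniformity_ub_def)
  show "open U \<longleftrightarrow> (\<forall>x\<in>U. \<forall>\<^sub>F (x', y) in uniformity. x' = x \<longrightarrow> y \<in> U)" for U :: "'a ub set"
    by (rule open_ub_def)
  show "norm f = 0 \<longleftrightarrow> f = 0"
  proof transfer
    fix f :: "'a \<Rightarrow> real" assume f: "f \<in> Ub"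
    have "f = (\<lambda>_. 0)" if "(SUP x. \<bar>f x\<bar>) = 0"
    proof
      fix x show "f x = 0"
        using cSUP_upper[OF UNIV_I bdd_above_Ub[OF f], of x] that by simp
    qed
    then show "((SUP x. \<bar>f x\<bar>) = 0) = (f = (\<lambda>_. 0))" by auto
  qed
  show "norm (f + g) \<le> norm f + norm g"
  proof transfer
    fix f g :: "'a \<Rightarrow> real" assume f: "f \<in> Ub" and g: "g \<in> Ub"
    show "(SUP x. \<bar>f x + g x\<bar>) \<le> (SUP x. \<bar>f x\<bar>) + (SUP x. \<bar>g x\<bar>)"
    proof (rule cSUP_least)
      fix x
      show "\<bar>f x + g x\<bar> \<le> (SUP x. \<bar>f x\<bar>) + (SUP x. \<bar>g x\<bar>)"
        using cSUP_upper[OF UNIV_I bdd_above_Ub[OF f], of x]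
          cSUP_upper[OF UNIV_I bdd_above_Ub[OF g], of x] by linarith
    qed simp
  qed
  show "norm (a *\<^sub>R f) = \<bar>a\<bar> * norm f"
  proof transfer
    fix a :: real and f :: "'a \<Rightarrow> real" assume f: "f \<in> Ub"
    have "\<bar>a\<bar> * (SUP x. \<bar>f x\<bar>) = (SUP x. \<bar>a\<bar> * \<bar>f x\<bar>)"
    proof (cases "a = 0")
      case False
      show ?thesis
      proof (rule antisym)
        have "(SUP x. \<bar>f x\<bar>) \<le> (SUP x. \<bar>a\<bar> * \<bar>f x\<bar>) / \<bar>a\<bar>"
        proof (rule cSUP_least)
          fix x
          have "\<bar>a\<bar> * \<bar>f x\<bar> \<le> (SUP x. \<bar>a\<bar> * \<bar>f x\<bar>)"
            using bdd_above_Ub[OF scaleR_in_Ub[OF f, of a]]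
            by (intro cSUP_upper) (auto simp: abs_mult)
          then show "\<bar>f x\<bar> \<le> (SUP x. \<bar>a\<bar> * \<bar>f x\<bar>) / \<bar>a\<bar>"
            using False by (simp add: field_simps)
        qed simp
        then show "\<bar>a\<bar> * (SUP x. \<bar>f x\<bar>) \<le> (SUP x. \<bar>a\<bar> * \<bar>f x\<bar>)"
          using False by (simp add: field_simps)
        show "(SUP x. \<bar>a\<bar> * \<bar>f x\<bar>) \<le> \<bar>a\<bar> * (SUP x. \<bar>f x\<bar>)"
          by (intro cSUP_least mult_left_mono cSUP_upper bdd_above_Ub f) auto
      qed
    qed simp
    then show "(SUP x. \<bar>a * f x\<bar>) = \<bar>a\<bar> * (SUP x. \<bar>f x\<bar>)"
      by (simp add: abs_mult)
  qed
qed

end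

text \<open>The norm dual of the space of bounded uniformly continuous functions is the type \<open>'a ub \<Rightarrow>\<^sub>L real\<close>.\<close>


section \<open>Uniformly continuous pseudometrics\<close>

definition pseudometric :: "('a \<Rightarrow> 'a \<Rightarrow> real) \<Rightarrow> bool" where
  "pseudometric d \<longleftrightarrow>
    (\<forall>x y. 0 \<le> d x y) \<and> (\<forall>x. d x x = 0) \<and> (\<forall>x y. d x y = d y x) \<and>
    (\<forall>x y z. d x z \<le> d x y + d y z)"

definition ucp :: "('a::uniform_space \<Rightarrow> 'a \<Rightarrow> real) \<Rightarrow> bool" where
  "ucp d \<longleftrightarrow> pseudometric d \<and> uniformly_continuous_on UNIV (\<lambda>(x, y). d x y)"

definition Lip :: "('a \<Rightarrow> 'a \<Rightarrow> real) \<Rightarrow> ('a \<Rightarrow> real) set" where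
  "Lip d = {f. (\<forall>x. \<bar>f x\<bar> \<le> 1) \<and> (\<forall>x x'. \<bar>f x - f x'\<bar> \<le> d x x')}"

lemma Lip_subset_Ub:
  assumes "ucp d"
  shows "Lip d \<subseteq> Ub"
proof
  fix f assume f: "f \<in> Lip d"
  have "eventually (\<lambda>(x, y). dist (f x) (f y) < e) uniformity" if "e > 0" for e
  proof -
    have "eventually (\<lambda>(p, q). dist (case p of (x, y) \<Rightarrow> d x y) (case q of (x, y) \<Rightarrow> d x y) < e)
        (uniformity :: (('a \<times> 'a) \<times> 'a \<times> 'a) filter)"
      using assms that unfolding ucp_def uniformly_continuous_on_UNIV_dist_iff by blast
    then obtain P Q where P: "eventually P uniformity" and Q: "eventually Q uniformity"
      and PQ: "\<And>x x' y y'. P (x, x') \<Longrightarrow> Q (y, y') \<Longrightarrow> dist (d x y) (d x' y') < e"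
      unfolding uniformity_prod_def eventually_filtermap eventually_prod_filter
      by (auto simp: case_prod_unfold)
    show ?thesis
      using P
    proof eventually_elim
      case (elim p)
      obtain x y where p: "p = (x, y)" by (cases p)
      have "dist (d x y) (d y y) < e"
        using PQ elim p uniformity_refl[OF Q] by blast
      moreover have "d y y = 0"
        using assms by (simp add: ucp_def pseudometric_def)
      moreover have "\<bar>f x - f y\<bar> \<le> d x y"
        using f by (simp add: Lip_def)
      ultimately show ?case
        using p by (simp add: dist_real_def)
    qed
  qed
  moreover have "bounded (range f)"
    using f by (auto simp: Lip_def bounded_iff)
  ultimately show "f \<in> Ub"
    by (simp add: Ub_def uniformly_continuous_on_UNIV_dist_iff)
qed


section \<open>Uniform measures\<close>

text \<open>
  The topology on \<open>'a \<Rightarrow> real\<close> is the product topology, that is, pointwise convergence.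
  By \<open>Lip_subset_Ub\<close>, the values of \<open>Abs_ub\<close> used here are the intended ones.
\<close>

definition M\<^sub>u :: "('a::uniform_space ub \<Rightarrow>\<^sub>L real) set" where
  "M\<^sub>u = {\<mu>. \<forall>d. ucp d \<longrightarrow> continuous_on (Lip d) (\<lambda>f. blinfun_apply \<mu> (Abs_ub f))}"


section \<open>Signed measures\<close>

definition bounded_signed_measure :: "'a measure \<Rightarrow> ('a set \<Rightarrow> real) \<Rightarrow> bool" where
  "bounded_signed_measure M m \<longleftrightarrow>
    m {} = 0 \<and>
    (\<forall>A :: nat \<Rightarrow> 'a set. range A \<subseteq> sets M \<and> disjoint_family A \<longrightarrow>
      (\<lambda>i. m (A i)) sums m (\<Union>i. A i)) \<and>
    (\<exists>C. \<forall>A\<in>sets M. \<bar>m A\<bar> \<le> C)"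

text \<open>
  The upper variation \<open>m\<^sup>+\<close> of the Jordan decomposition; the lower variation \<open>m\<^sup>-\<close> is the
  upper variation of \<open>-m\<close>.  Only the sigma-algebra of \<open>M\<close> is relevant.
\<close>

definition upper_variation :: "'a measure \<Rightarrow> ('a set \<Rightarrow> real) \<Rightarrow> 'a measure" where
  "upper_variation M m =
    measure_of (space M) (sets M) (\<lambda>A. ennreal (SUP B\<in>{B \<in> sets M. B \<subseteq> A}. m B))"

lemma bounded_signed_measure_uminus:
  assumes "bounded_signed_measure M m"
  shows "bounded_signed_measure M (\<lambda>A. - m A)"
  using assms by (auto simp: bounded_signed_measure_def intro: sums_minus)

text \<open>The variations are genuine measures, so \<open>measure_of\<close> does not collapse to the null measure.\<close>

lemma
  assumes m: "bounded_signed_measure M m"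
  shows space_upper_variation: "space (upper_variation M m) = space M"
    and sets_upper_variation: "sets (upper_variation M m) = sets M"
    and emeasure_upper_variation: "A \<in> sets M \<Longrightarrow>
      emeasure (upper_variation M m) A = ennreal (SUP B\<in>{B \<in> sets M. B \<subseteq> A}. m B)"
proof -
  define v where "v A = (SUP B\<in>{B \<in> sets M. B \<subseteq> A}. m B)" for A
  obtain C where C: "\<And>A. A \<in> sets M \<Longrightarrow> \<bar>m A\<bar> \<le> C"
    using m by (auto simp: bounded_signed_measure_def)
  have m0: "m {} = 0"
    and ms: "\<And>A :: nat \<Rightarrow> 'a set. range A \<subseteq> sets M \<Longrightarrow> disjoint_family A \<Longrightarrow>
      (\<lambda>i. m (A i)) sums m (\<Union>i. A i)"
    using m by (auto simp: bounded_signed_measure_def)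
  have bdd: "bdd_above (m ` {B \<in> sets M. B \<subseteq> A})" for A
    by (rule bdd_aboveI[of _ C]) (use C abs_le_D1 in blast)
  have le_v: "m B \<le> v A" if "B \<in> sets M" "B \<subseteq> A" for A B
    unfolding v_def using that by (intro cSUP_upper bdd) auto
  have v_nonneg: "0 \<le> v A" for A
    using le_v[of "{}" A] m0 by simp
  have v_le: "v A \<le> C" for A
    unfolding v_def using C by (intro cSUP_least) (auto intro: abs_le_D1)
  have add: "m (A \<union> B) = m A + m B" if "A \<in> sets M" "B \<in> sets M" "A \<inter> B = {}" for A B
  proof -
    have "(\<lambda>i. m (binaryset A B i)) sums m (\<Union>i. binaryset A B i)"
      using that by (intro ms) (auto simp: range_binaryset_eq disjoint_family_on_def binaryset_def)
    moreover have "(\<lambda>i. m (binaryset A B i)) sums (m A + m B)"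
      using binaryset_sums[of m A B] m0 by simp
    ultimately show ?thesis
      by (simp add: UN_binaryset_eq sums_iff)
  qed
  have v_fin: "v A + v B \<le> v (A \<union> B)" if "A \<inter> B = {}" for A B
  proof -
    have *: "m A' + m B' \<le> v (A \<union> B)"
      if "A' \<in> sets M" "A' \<subseteq> A" "B' \<in> sets M" "B' \<subseteq> B" for A' B'
    proof -
      have "m (A' \<union> B') = m A' + m B'"
        using that \<open>A \<inter> B = {}\<close> by (intro add) auto
      moreover have "m (A' \<union> B') \<le> v (A \<union> B)"
        using that by (intro le_v) auto
      ultimately show ?thesis by simp
    qed
    have "m A' \<le> v (A \<union> B) - v B" if "A' \<in> sets M" "A' \<subseteq> A" for A'
    proof -
      have "v B \<le> v (A \<union> B) - m A'"
        unfolding v_def[of B] using *[OF that] by (intro cSUP_least) (auto simp: algebra_simps)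
      then show ?thesis by simp
    qed
    then have "v A \<le> v (A \<union> B) - v B"
      unfolding v_def[of A] by (intro cSUP_least) auto
    then show ?thesis by simp
  qed
  have v_mono: "v A \<le> v B" if "A \<subseteq> B" for A B
    unfolding v_def[of A] using that by (intro cSUP_least le_v) auto
  have "countably_additive (sets M) (\<lambda>A. ennreal (v A))"
  proof (rule countably_additiveI)
    fix A :: "nat \<Rightarrow> 'a set"
    assume A: "range A \<subseteq> sets M" "disjoint_family A" "(\<Union>i. A i) \<in> sets M"
    have partial: "(\<Sum>i<n. v (A i)) \<le> v (\<Union>i<n. A i)" for n
    proof (induction n)
      case (Suc n)
      have "(\<Union>i<n. A i) \<inter> A n = {}"
        using disjoint_family_onD[OF A(2)] by (auto simp: disjoint_iff) (metis UNIV_I disjoint_iff nat_neq_iff)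
      from v_fin[OF this] show ?case
        using Suc by (simp add: lessThan_Suc Un_commute add.commute)
    qed (simp add: v_nonneg)
    have partial': "(\<Sum>i<n. v (A i)) \<le> v (\<Union>i. A i)" for n
      by (rule order_trans[OF partial v_mono]) auto
    have summ: "summable (\<lambda>i. v (A i))"
      using partial' v_nonneg by (intro summableI_nonneg_bounded) auto
    have "(\<Sum>i. v (A i)) = v (\<Union>i. A i)"
    proof (rule antisym)
      show "(\<Sum>i. v (A i)) \<le> v (\<Union>i. A i)"
        using partial' by (intro suminf_le_const summ) auto
      show "v (\<Union>i. A i) \<le> (\<Sum>i. v (A i))"
        unfolding v_def[of "\<Union>i. A i"]
      proof (rule cSUP_least)
        fix B assume B: "B \<in> {B \<in> sets M. B \<subseteq> (\<Union>i. A i)}"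
        have "(\<lambda>i. m (B \<inter> A i)) sums m (\<Union>i. B \<inter> A i)"
          using A B by (intro ms) (auto simp: disjoint_family_on_def)
        moreover have "(\<Union>i. B \<inter> A i) = B" using B by auto
        moreover have "m (B \<inter> A i) \<le> v (A i)" for i
          using A B by (intro le_v) auto
        ultimately show "m B \<le> (\<Sum>i. v (A i))"
          using sums_le[of "\<lambda>i. m (B \<inter> A i)" "\<lambda>i. v (A i)" "m B"] summable_sums[OF summ] by simp
      qed auto
    qed
    then show "(\<Sum>i. ennreal (v (A i))) = ennreal (v (\<Union>i. A i))"
      using summ v_nonneg by (simp add: suminf_ennreal_eq[OF _ summable_sums[OF summ]])
  qed
  moreover have "v {} = 0"
  proof -
    have "{B \<in> sets M. B \<subseteq> {}} = {{}}" by auto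
    then show ?thesis by (simp add: v_def m0)
  qed
  ultimately have "measure_space (space M) (sets M) (\<lambda>A. ennreal (v A))"
    by (simp add: measure_space_def positive_def sets.sigma_algebra_axioms)
  then show "A \<in> sets M \<Longrightarrow>
      emeasure (upper_variation M m) A = ennreal (SUP B\<in>{B \<in> sets M. B \<subseteq> A}. m B)"
    unfolding upper_variation_def v_def
    by (subst emeasure_measure_of_sigma) (simp_all add: measure_space_def sets.sigma_algebra_axioms)
  show "space (upper_variation M m) = space M" "sets (upper_variation M m) = sets M"
    by (simp_all add: upper_variation_def)
qed

definition signed_integral :: "'a measure \<Rightarrow> ('a set \<Rightarrow> real) \<Rightarrow> ('a \<Rightarrow> real) \<Rightarrow> real" where
  "signed_integral M m f =
    integral\<^sup>L (upper_variation M m) f - integral\<^sup>L (upper_variation M (\<lambda>A. - m A)) f"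

definition Coz :: "'a::uniform_space set set" where
  "Coz = {{x. f x \<noteq> 0} | f. f \<in> Ub}"

definition M\<^sub>\<sigma> :: "('a::uniform_space ub \<Rightarrow>\<^sub>L real) set" where
  "M\<^sub>\<sigma> = {\<mu>. \<exists>m. bounded_signed_measure (sigma UNIV Coz) m \<and>
    (\<forall>f. blinfun_apply \<mu> f = signed_integral (sigma UNIV Coz) m (apply_ub f))}"


section \<open>Cardinals of measure zero and D-spaces\<close>

text \<open>A cardinal is given as a well-order relation \<open>\<kappa>\<close>, as in the cardinal library.\<close>

definition measure_zero_cardinal :: "'a rel \<Rightarrow> bool" where
  "measure_zero_cardinal \<kappa> \<longleftrightarrow>
    (\<forall>A :: 'a set. (card_of A, \<kappa>) \<in> ordIso \<longrightarrow>
      (\<forall>M. space M = A \<and> sets M = Pow A \<and> finite_measure M \<and> (\<forall>a\<in>A. emeasure M {a} = 0) \<longrightarrow>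
        emeasure M A = 0))"

definition uniformly_discrete_wrt :: "('a \<Rightarrow> 'a \<Rightarrow> real) \<Rightarrow> 'a set \<Rightarrow> bool" where
  "uniformly_discrete_wrt d Y \<longleftrightarrow> (\<exists>\<epsilon>>0. \<forall>y\<in>Y. \<forall>y'\<in>Y. y \<noteq> y' \<longrightarrow> d y y' \<ge> \<epsilon>)"

definition uniformly_discrete :: "'a::uniform_space set \<Rightarrow> bool" where
  "uniformly_discrete Y \<longleftrightarrow> (\<exists>d. ucp d \<and> uniformly_discrete_wrt d Y)"

definition uniform_D_space :: "'a::uniform_space itself \<Rightarrow> bool" where
  "uniform_D_space _ \<longleftrightarrow>
    (\<forall>Y :: 'a set. uniformly_discrete Y \<longrightarrow> measure_zero_cardinal (card_of Y))"

end

theory Submission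
  imports Defs
begin

text \<open>
  Both directions turn on what a countably additive measure does with an uncountable family of
  pairwise separated pieces.

  If \<open>X\<close> is not a D-space, some uniformly discrete set \<open>Y\<close> carries a non-zero finite measure on
  all of its subsets that vanishes on points. Pushed forward to \<open>X\<close>, it gives an element of
  \<open>M\<^sub>\<sigma>\<close>. The Lipschitz bump around \<open>Y\<close> is the pointwise limit of the bumps around the finite
  subsets of \<open>Y\<close>; these have integral \<open>0\<close> and the limit does not, so the functional is not
  continuous on \<open>Lip d\<close> (\<open>uniformly_discrete_measure_zero\<close>).

  Conversely let \<open>X\<close> be a D-space. By the Jordan decomposition it suffices to treat integration
  against a finite non-negative measure \<open>N\<close>. The heart of the proof is that for every \<open>\<epsilon> > 0\<close>
  countably many \<open>d\<close>-balls of radius \<open>\<epsilon>\<close> cover \<open>N\<close>-almost all of \<open>X\<close>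
  (\<open>countable_ball_cover\<close>). Well-order \<open>X\<close> and let \<open>a x\<close> be the first \<open>\<alpha>\<close> with
  \<open>d x \<alpha> < \<epsilon>\<close>. On the stratum of those \<open>x\<close> with \<open>d x (a x) \<le> \<epsilon> - 1/(n + 1)\<close>, points with
  different \<open>a\<close> are at distance at least \<open>1/(n + 1)\<close>, and so are the values of \<open>a\<close> themselves.
  This is the idea behind the theorem of A. H. Stone that metric spaces are paracompact. The first
  separation makes every union of fibres of \<open>a\<close> in the stratum \<open>d\<close>-closed, hence measurable, so that \<open>N\<close>
  induces a measure on all subsets of the index set; the second makes the index set uniformly
  discrete, so the D-property says that this measure lives on its countably many atoms.

  Given such covers, finitely many balls of radius \<open>\<eta>\<close> already cover \<open>X\<close> up to small measure.
  Two functions of \<open>Lip d\<close> that are \<open>\<eta>\<close>-close at the centres are \<open>3 \<eta>\<close>-close on those balls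
  and differ by at most \<open>2\<close> elsewhere, so their integrals are close
  (\<open>integral_continuous_on_Lip\<close>).
\<close>

section \<open>Pseudometric bumps and measurability\<close>

lemma pseudometricD:
  assumes "pseudometric d"
  shows "0 \<le> d x y" "d x x = 0" "d x y = d y x" "d x z \<le> d x y + d y z"
  using assms unfolding pseudometric_def by blast+

text \<open>
  This is \<open>max 0 (r - d(x, S))\<close>. Writing it as a supremum that includes \<open>0\<close> avoids the distance
  to the empty set: the bump around \<open>{}\<close> is \<open>0\<close>.
\<close>

definition bump :: "('a \<Rightarrow> 'a \<Rightarrow> real) \<Rightarrow> real \<Rightarrow> 'a set \<Rightarrow> 'a \<Rightarrow> real" where
  "bump d r S x = Sup (insert 0 ((\<lambda>y. r - d x y) ` S))"

lemma bump_upper: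
  assumes "pseudometric d" "0 \<le> r"
  shows "0 \<le> bump d r S x" "y \<in> S \<Longrightarrow> r - d x y \<le> bump d r S x"
proof -
  have "bdd_above (insert 0 ((\<lambda>y. r - d x y) ` S))"
    using assms pseudometricD(1)[OF assms(1)] by (intro bdd_aboveI[of _ r]) auto
  then show "0 \<le> bump d r S x" "y \<in> S \<Longrightarrow> r - d x y \<le> bump d r S x"
    unfolding bump_def by (auto intro: cSup_upper)
qed

lemma bump_least:
  assumes "0 \<le> c" "\<And>y. y \<in> S \<Longrightarrow> r - d x y \<le> c"
  shows "bump d r S x \<le> c"
  unfolding bump_def using assms by (intro cSup_least) auto

lemma bump_in_Lip:
  assumes "pseudometric d" "0 \<le> r" "r \<le> 1"
  shows "bump d r S \<in> Lip d"
proof -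
  note d = pseudometricD[OF assms(1)] and up = bump_upper[OF assms(1,2)]
  have "bump d r S x \<le> 1" for x
  proof (rule bump_least)
    show "r - d x y \<le> 1" for y using d(1)[of x y] assms(3) by linarith
  qed simp
  moreover have "bump d r S x \<le> bump d r S x' + d x x'" for x x'
  proof (rule bump_least)
    show "0 \<le> bump d r S x' + d x x'"
      using up(1)[of S x'] d(1)[of x x'] by linarith
    show "r - d x y \<le> bump d r S x' + d x x'" if "y \<in> S" for y
      using up(2)[OF that, of x'] d(4)[of x' y x] d(3)[of x x'] by linarith
  qed
  ultimately show ?thesis
    using up(1) d(3) unfolding Lip_def by (auto simp: abs_le_iff) (smt (verit))+
qed

abbreviation coz_algebra :: "'a::uniform_space measure" where
  "coz_algebra \<equiv> sigma UNIV Coz"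

lemma sets_coz_algebra: "sets coz_algebra = sigma_sets UNIV Coz"
  by (rule sets_measure_of) auto

text \<open>
  The hypothesis says that \<open>S\<close> contains every point at \<open>d\<close>-distance \<open>0\<close> from it. Then \<open>S\<close> is
  exactly where the bump of height \<open>1\<close> around it equals \<open>1\<close>, so the complement is a cozero set.
\<close>

lemma pseudometric_closed_measurable:
  assumes "ucp d" "\<And>x. (\<And>r. r > 0 \<Longrightarrow> \<exists>y\<in>S. d x y < r) \<Longrightarrow> x \<in> S"
  shows "S \<in> sets coz_algebra"
proof -
  have d: "pseudometric d"
    using assms(1) by (simp add: ucp_def)
  have "bump d 1 S \<in> Ub"
    using bump_in_Lip[OF d, of 1 S] Lip_subset_Ub[OF assms(1)] by auto
  moreover have "(\<lambda>x. 1) \<in> (Ub :: ('a \<Rightarrow> real) set)"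
    by (auto simp: Ub_def uniformly_continuous_on_UNIV_dist_iff image_def case_prod_unfold)
  ultimately have "(\<lambda>x. 1 + -1 * bump d 1 S x) \<in> Ub"
    by (intro add_in_Ub scaleR_in_Ub)
  moreover have "- S = {x. 1 + -1 * bump d 1 S x \<noteq> 0}"
  proof (intro set_eqI iffI; clarsimp)
    fix x assume x: "x \<notin> S" "bump d 1 S x = 1"
    from x(1) assms(2) obtain r where r: "r > 0" "\<And>y. y \<in> S \<Longrightarrow> d x y \<ge> r"
      by (meson not_le)
    have "bump d 1 S x \<le> max 0 (1 - r)"
      using r(2) by (intro bump_least) (auto simp: le_max_iff_disj)
    then show False using x r(1) by simp
  next
    fix x assume x: "x \<in> S" "bump d 1 S x \<noteq> 1"
    have "1 \<le> bump d 1 S x"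
      using bump_upper(2)[OF d, of 1 x S x] x(1) pseudometricD(2)[OF d] by simp
    moreover have "bump d 1 S x \<le> 1"
      using pseudometricD(1)[OF d] by (intro bump_least) auto
    ultimately show False using x(2) by simp
  qed
  ultimately have "- S \<in> Coz"
    unfolding Coz_def by (intro CollectI exI[of _ "\<lambda>x. 1 + -1 * bump d 1 S x"] conjI)
  then have "UNIV - (- S) \<in> sigma_sets UNIV Coz"
    by (intro sigma_sets.Compl sigma_sets.Basic)
  then show ?thesis
    by (simp add: sets_coz_algebra Compl_eq_Diff_UNIV double_diff)
qed

text \<open>
  The strict superlevel set of \<open>f\<close> at \<open>c\<close> is the cozero set of the positive part of \<open>f - c\<close>.
\<close>

lemma Ub_measurable:
  assumes f: "f \<in> Ub"
  shows "f \<in> borel_measurable coz_algebra"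
proof (rule borel_measurableI_greater)
  fix c :: real
  have le: "dist (max (f x - c) 0) (max (f y - c) 0) \<le> dist (f x) (f y)" for x y
    by (auto simp: dist_real_def)
  have "eventually (\<lambda>(x, y). dist (max (f x - c) 0) (max (f y - c) 0) < e) uniformity"
    if "e > 0" for e
  proof -
    have "eventually (\<lambda>(x, y). dist (f x) (f y) < e) uniformity"
      using f that unfolding Ub_def uniformly_continuous_on_UNIV_dist_iff by blast
    then show ?thesis
      by (rule eventually_mono) (auto intro: le_less_trans[OF le])
  qed
  then have "uniformly_continuous_on UNIV (\<lambda>x. max (f x - c) 0)"
    by (simp add: uniformly_continuous_on_UNIV_dist_iff)
  moreover have "bounded (range (\<lambda>x. max (f x - c) 0))"
  proof -
    obtain B where B: "\<And>x. \<bar>f x\<bar> \<le> B"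
      using f by (auto simp: Ub_def bounded_iff)
    have "\<bar>max (f x - c) 0\<bar> \<le> B + \<bar>c\<bar>" for x
      using B[of x] by linarith
    then show ?thesis by (auto simp: bounded_iff)
  qed
  ultimately have "(\<lambda>x. max (f x - c) 0) \<in> Ub"
    by (simp add: Ub_def)
  moreover have "{x. c < f x} = {x. max (f x - c) 0 \<noteq> 0}"
    by auto
  ultimately have "{x. c < f x} \<in> Coz"
    unfolding Coz_def by (intro CollectI exI[of _ "\<lambda>x. max (f x - c) 0"] conjI)
  then show "{x \<in> space coz_algebra. c < f x} \<in> sets coz_algebra"
    by (simp add: sets_coz_algebra space_measure_of_conv)
qed

lemma Ub_integrable:
  assumes "f \<in> Ub" "finite_measure N" "sets N = sets coz_algebra"
  shows "integrable N f"
proof -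
  obtain B where "\<And>x. \<bar>f x\<bar> \<le> B"
    using assms(1) by (auto simp: Ub_def bounded_iff)
  moreover have "f \<in> borel_measurable N"
    using Ub_measurable[OF assms(1)] measurable_cong_sets[OF assms(3) refl] by blast
  ultimately show ?thesis
    by (intro finite_measure.integrable_const_bound[OF assms(2), of _ B]) auto
qed

section \<open>Non-negative measures as signed measures\<close>

lemma finite_measure_upper_variation:
  assumes "bounded_signed_measure M m"
  shows "finite_measure (upper_variation M m)"
  by (rule finite_measureI)
    (simp add: space_upper_variation[OF assms] emeasure_upper_variation[OF assms])

lemma bounded_signed_measure_measure:
  assumes "finite_measure N" "sets N = sets M"
  shows "bounded_signed_measure M (measure N)"
  unfolding bounded_signed_measure_def
proof (intro conjI allI impI)
  interpret finite_measure N by fact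
  show "\<exists>C. \<forall>A\<in>sets M. \<bar>measure N A\<bar> \<le> C"
    using bounded_measure by auto
  show "(\<lambda>i. measure N (A i)) sums measure N (\<Union>i. A i)"
    if "range A \<subseteq> sets M \<and> disjoint_family A" for A :: "nat \<Rightarrow> _"
    using that assms(2) by (intro finite_measure_UNION) auto
qed simp

text \<open>
  A non-negative measure is monotone, so the supremum over subsets in its upper variation is
  attained at the whole set, and the one in its lower variation at the empty set.
\<close>

lemma signed_integral_measure:
  assumes N: "finite_measure N" "sets N = sets M"
  shows "signed_integral M (measure N) f = integral\<^sup>L N f"
proof -
  interpret finite_measure N by fact
  note bsm = bounded_signed_measure_measure[OF N]
  note bsm' = bounded_signed_measure_uminus[OF bsm]
  have "upper_variation M (measure N) = N"
  proof (rule measure_eqI)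
    fix A assume "A \<in> sets (upper_variation M (measure N))"
    then have A: "A \<in> sets M"
      by (simp add: sets_upper_variation[OF bsm])
    have "(SUP B\<in>{B \<in> sets M. B \<subseteq> A}. measure N B) = measure N A"
      using A N(2) by (intro cSup_eq_maximum) (auto intro: finite_measure_mono)
    then show "emeasure (upper_variation M (measure N)) A = emeasure N A"
      by (simp add: emeasure_upper_variation[OF bsm A] emeasure_eq_measure)
  qed (simp add: sets_upper_variation[OF bsm] N(2))
  moreover have "upper_variation M (\<lambda>A. - measure N A) = null_measure M"
  proof (rule measure_eqI)
    fix A assume "A \<in> sets (upper_variation M (\<lambda>A. - measure N A))"
    then have A: "A \<in> sets M"
      by (simp add: sets_upper_variation[OF bsm'])
    have "(SUP B\<in>{B \<in> sets M. B \<subseteq> A}. - measure N B) = 0"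
      by (intro cSup_eq_maximum) (auto intro!: image_eqI[of _ _ "{}"])
    then show "emeasure (upper_variation M (\<lambda>A. - measure N A)) A = emeasure (null_measure M) A"
      by (simp add: emeasure_upper_variation[OF bsm' A])
  qed (simp add: sets_upper_variation[OF bsm'])
  ultimately show ?thesis
    by (simp add: signed_integral_def)
qed

lemma integral_functional_in_M\<sigma>:
  fixes N :: "'a::uniform_space measure"
  assumes N: "finite_measure N" "sets N = sets coz_algebra"
  obtains \<mu> where "\<mu> \<in> M\<^sub>\<sigma>" "\<And>f. blinfun_apply \<mu> f = integral\<^sup>L N (apply_ub f)"
proof -
  interpret finite_measure N by fact
  have int: "integrable N (apply_ub f)" for f
    using apply_ub N by (rule Ub_integrable)
  have lin: "bounded_linear (\<lambda>f. integral\<^sup>L N (apply_ub f))"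
  proof (rule bounded_linear_intro)
    fix f g :: "'a ub" and c :: real
    show "integral\<^sup>L N (apply_ub (f + g)) = integral\<^sup>L N (apply_ub f) + integral\<^sup>L N (apply_ub g)"
      by (simp add: plus_ub.rep_eq int)
    show "integral\<^sup>L N (apply_ub (c *\<^sub>R f)) = c *\<^sub>R integral\<^sup>L N (apply_ub f)"
      by (simp add: scaleR_ub.rep_eq)
    have "\<bar>apply_ub f x\<bar> \<le> norm f" for x
      unfolding norm_ub.rep_eq by (intro cSUP_upper bdd_above_Ub apply_ub) simp
    then have "integral\<^sup>L N (\<lambda>x. norm (apply_ub f x)) \<le> integral\<^sup>L N (\<lambda>x. norm f)"
      by (intro integral_mono integrable_norm int) auto
    then show "norm (integral\<^sup>L N (apply_ub f)) \<le> norm f * measure N (space N)"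
      using order_trans[OF integral_norm_bound[of N "apply_ub f"]] by (simp add: mult.commute)
  qed
  show thesis
  proof (rule that)
    show ap: "blinfun_apply (Blinfun (\<lambda>f. integral\<^sup>L N (apply_ub f))) f = integral\<^sup>L N (apply_ub f)" for f
      by (simp add: bounded_linear_Blinfun_apply[OF lin])
    show "Blinfun (\<lambda>f. integral\<^sup>L N (apply_ub f)) \<in> M\<^sub>\<sigma>"
      unfolding M\<^sub>\<sigma>_def using bounded_signed_measure_measure[OF N] signed_integral_measure[OF N] ap
      by (intro CollectI exI[of _ "measure N"]) simp
  qed
qed

section \<open>Uniform measures force the D-property\<close>

lemma tendsto_bump_finite_subsets:
  assumes d: "pseudometric d" "0 \<le> r"
  shows "((\<lambda>F. bump d r F) \<longlongrightarrow> bump d r Y) (finite_subsets_at_top Y)"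
proof -
  note up = bump_upper[OF d]
  have "((\<lambda>F. bump d r F x) \<longlongrightarrow> bump d r Y x) (finite_subsets_at_top Y)" for x
  proof (rule order_tendstoI)
    fix c assume c: "c < bump d r Y x"
    show "\<forall>\<^sub>F F in finite_subsets_at_top Y. c < bump d r F x"
    proof (cases "c < 0")
      case True
      then show ?thesis using up(1) by (intro always_eventually) (auto intro: less_le_trans)
    next
      case False
      then obtain y where y: "y \<in> Y" "c < r - d x y"
        using c bump_least[of c Y r d x] by (meson not_le)
      have "c < bump d r F x" if "{y} \<subseteq> F" for F
        using up(2)[of y F x] that y(2) by simp
      then show ?thesis
        using y(1) unfolding eventually_finite_subsets_at_top by (intro exI[of _ "{y}"]) auto
    qed
  next
    fix c assume c: "bump d r Y x < c"
    have "bump d r F x \<le> bump d r Y x" if "F \<subseteq> Y" for F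
      using that up by (intro bump_least) auto
    then show "\<forall>\<^sub>F F in finite_subsets_at_top Y. bump d r F x < c"
      unfolding eventually_finite_subsets_at_top using c by (intro exI[of _ "{}"]) (auto intro: le_less_trans)
  qed
  then have "limitin (product_topology (\<lambda>_. euclidean) UNIV) (bump d r) (bump d r Y)
      (finite_subsets_at_top Y)"
    by (simp add: limitin_componentwise)
  then show ?thesis
    by (simp add: euclidean_product_topology)
qed

text \<open>
  The bumps around finite subsets of \<open>Y\<close> only see finitely many points and are therefore killed
  by a measure that vanishes on points; continuity carries this to the bump around \<open>Y\<close>, whose
  integral is a positive multiple of the total mass.
\<close>

lemma uniformly_discrete_measure_zero:
  fixes Y :: "'a::uniform_space set"
  assumes sub: "(M\<^sub>\<sigma> :: ('a ub \<Rightarrow>\<^sub>L real) set) \<subseteq> M\<^sub>u" and Y: "uniformly_discrete Y"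
  shows "measure_zero_cardinal (card_of Y)"
  unfolding measure_zero_cardinal_def
proof (intro allI impI)
  fix A :: "'a set" and M :: "'a measure"
  assume "(card_of A, card_of Y) \<in> ordIso"
    and M: "space M = A \<and> sets M = Pow A \<and> finite_measure M \<and> (\<forall>a\<in>A. emeasure M {a} = 0)"
  then have "\<exists>h. bij_betw h A Y"
    by (simp only: card_of_ordIso)
  then obtain h where h: "bij_betw h A Y"
    by (rule exE)
  interpret finite_measure M using M by simp
  obtain d \<epsilon> where d: "ucp d" "\<epsilon> > 0" "\<And>y y'. y \<in> Y \<Longrightarrow> y' \<in> Y \<Longrightarrow> y \<noteq> y' \<Longrightarrow> \<epsilon> \<le> d y y'"
    using Y unfolding uniformly_discrete_def uniformly_discrete_wrt_def by blast
  have pd: "pseudometric d" using d(1) by (simp add: ucp_def)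
  \<comment> \<open>Height at most \<open>1\<close> keeps the bumps in \<open>Lip d\<close>; at most \<open>\<epsilon>\<close> makes the bump around
    \<open>S \<subseteq> Y\<close> vanish on the rest of \<open>Y\<close>.\<close>
  define r where "r = min 1 \<epsilon>"
  have r: "0 < r" "r \<le> 1" "r \<le> \<epsilon>" using d(2) by (auto simp: r_def)
  have meas: "h \<in> M \<rightarrow>\<^sub>M coz_algebra"
    using M by (intro measurableI) (auto simp: space_measure_of_conv)
  have fin: "finite_measure (distr M coz_algebra h)"
    by (rule finite_measure_distr[OF meas])
  obtain \<mu> where \<mu>: "\<mu> \<in> M\<^sub>\<sigma>"
    "\<And>f. blinfun_apply \<mu> f = integral\<^sup>L (distr M coz_algebra h) (apply_ub f)"
    using integral_functional_in_M\<sigma>[OF fin sets_distr] by blast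
  have Lip: "bump d r S \<in> Lip d" for S
    using r by (intro bump_in_Lip pd) auto
  have val: "blinfun_apply \<mu> (Abs_ub (bump d r S)) = r * measure M (h -` S \<inter> A)" if "S \<subseteq> Y" for S
  proof -
    have ub: "bump d r S \<in> Ub" using Lip Lip_subset_Ub[OF d(1)] by blast
    have at: "bump d r S (h x) = r * indicator (h -` S \<inter> A) x" if "x \<in> space M" for x
    proof -
      have xA: "x \<in> A" and hx: "h x \<in> Y" using that M h by (auto simp: bij_betw_def)
      have "bump d r S (h x) = r" if "h x \<in> S"
        using bump_upper(2)[OF pd _ that, of r "h x"] pseudometricD(1,2)[OF pd] r(1)
        by (intro antisym bump_least) auto
      moreover have "bump d r S (h x) = 0" if "h x \<notin> S"
      proof (rule antisym)
        show "bump d r S (h x) \<le> 0"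
        proof (rule bump_least)
          fix y assume "y \<in> S"
          then have "\<epsilon> \<le> d (h x) y" using d(3)[of "h x" y] hx \<open>S \<subseteq> Y\<close> that by auto
          then show "r - d (h x) y \<le> 0" using r by simp
        qed simp
      qed (use bump_upper(1)[OF pd] r in auto)
      ultimately show ?thesis using xA by (auto simp: indicator_def)
    qed
    have "blinfun_apply \<mu> (Abs_ub (bump d r S)) = integral\<^sup>L M (\<lambda>x. bump d r S (h x))"
      by (simp add: \<mu>(2) Abs_ub_inverse ub integral_distr[OF meas] Ub_measurable)
    also have "\<dots> = integral\<^sup>L M (\<lambda>x. r * indicator (h -` S \<inter> A) x)"
      by (intro Bochner_Integration.integral_cong at) auto
    also have "\<dots> = r * measure M (h -` S \<inter> A)"
      using M by (simp add: Int_absorb2)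
    finally show ?thesis .
  qed
  have cont: "continuous_on (Lip d) (\<lambda>f. blinfun_apply \<mu> (Abs_ub f))"
    using sub \<mu>(1) d(1) by (auto simp: M\<^sub>u_def)
  have lim: "((\<lambda>F. blinfun_apply \<mu> (Abs_ub (bump d r F)))
      \<longlongrightarrow> blinfun_apply \<mu> (Abs_ub (bump d r Y))) (finite_subsets_at_top Y)"
    by (rule continuous_on_tendsto_compose[OF cont tendsto_bump_finite_subsets])
      (use r(1) in \<open>auto simp: Lip pd\<close>)
  have zero: "blinfun_apply \<mu> (Abs_ub (bump d r F)) = 0" if F: "finite F" "F \<subseteq> Y" for F
  proof -
    have "finite (h -` F \<inter> A)"
      using F(1) bij_betw_imp_inj_on[OF h] by (rule finite_vimage_IntI)
    then have "measure M (h -` F \<inter> A) = (\<Sum>a\<in>h -` F \<inter> A. measure M {a})"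
      using M by (intro finite_measure_eq_sum_singleton) auto
    also have "\<dots> = 0"
      using M by (intro sum.neutral) (auto simp: measure_def)
    finally show ?thesis using val[OF F(2)] by simp
  qed
  have "((\<lambda>F. blinfun_apply \<mu> (Abs_ub (bump d r F))) \<longlongrightarrow> 0) (finite_subsets_at_top Y)"
    using zero by (intro tendsto_eventually) (auto simp: eventually_finite_subsets_at_top)
  then have "blinfun_apply \<mu> (Abs_ub (bump d r Y)) = 0"
    using tendsto_unique[OF _ lim] by simp
  then have "measure M (h -` Y \<inter> A) = 0"
    using val[of Y] r(1) by simp
  moreover have "h -` Y \<inter> A = A"
    using h by (auto simp: bij_betw_def)
  ultimately show "emeasure M A = 0"
    by (simp add: emeasure_eq_measure)
qed

section \<open>Almost everywhere countable covers by balls\<close>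

text \<open>
  Take for \<open>r\<close> the strict part of a well-order and for \<open>a x\<close> the \<open>r\<close>-least centre whose
  \<open>\<epsilon>\<close>-ball contains \<open>x\<close>. The characterisation of \<open>a x\<close> is an equivalence because both
  directions matter: one separates points with different \<open>a\<close>, the other recognises the value
  of \<open>a\<close> at a limit point.
\<close>

lemma first_centre:
  assumes "\<And>x. d x x = 0" "\<epsilon> > (0::real)"
  obtains r :: "'a rel" and a :: "'a \<Rightarrow> 'a"
  where "\<And>\<alpha> \<beta>. \<alpha> \<noteq> \<beta> \<Longrightarrow> (\<alpha>, \<beta>) \<in> r \<or> (\<beta>, \<alpha>) \<in> r"
    "\<And>x \<alpha>. a x = \<alpha> \<longleftrightarrow> d x \<alpha> < \<epsilon> \<and> (\<forall>\<beta>. (\<beta>, \<alpha>) \<in> r \<longrightarrow> \<epsilon> \<le> d x \<beta>)"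
proof -
  obtain w :: "'a rel" where w: "well_order_on UNIV w"
    using well_order_on by blast
  define r where "r = w - Id"
  have wf: "wf r" and tot: "\<alpha> \<noteq> \<beta> \<Longrightarrow> (\<alpha>, \<beta>) \<in> r \<or> (\<beta>, \<alpha>) \<in> r" for \<alpha> \<beta>
    using w by (auto simp: r_def well_order_on_def linear_order_on_def total_on_def)
  have "\<exists>\<alpha>. d x \<alpha> < \<epsilon> \<and> (\<forall>\<beta>. (\<beta>, \<alpha>) \<in> r \<longrightarrow> \<epsilon> \<le> d x \<beta>)" for x
  proof -
    have "x \<in> {\<alpha>. d x \<alpha> < \<epsilon>}" using assms by simp
    then obtain \<alpha> where "\<alpha> \<in> {\<alpha>. d x \<alpha> < \<epsilon>}" "\<And>\<beta>. (\<beta>, \<alpha>) \<in> r \<Longrightarrow> \<beta> \<notin> {\<alpha>. d x \<alpha> < \<epsilon>}"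
      by (rule wfE_min[OF wf]) blast
    then show ?thesis by (intro exI[of _ \<alpha>]) (auto simp: not_less)
  qed
  then obtain a where a: "d x (a x) < \<epsilon>" "\<And>\<beta>. (\<beta>, a x) \<in> r \<Longrightarrow> \<epsilon> \<le> d x \<beta>" for x
    by metis
  have "a x = \<alpha>" if "d x \<alpha> < \<epsilon>" "\<forall>\<beta>. (\<beta>, \<alpha>) \<in> r \<longrightarrow> \<epsilon> \<le> d x \<beta>" for x \<alpha>
    using tot[of "a x" \<alpha>] a(1)[of x] a(2)[of \<alpha> x] that by force
  then have "a x = \<alpha> \<longleftrightarrow> d x \<alpha> < \<epsilon> \<and> (\<forall>\<beta>. (\<beta>, \<alpha>) \<in> r \<longrightarrow> \<epsilon> \<le> d x \<beta>)" for x \<alpha>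
    using a by blast
  with tot show thesis by (rule that)
qed

text \<open>
  The push-forward of \<open>N\<close>, restricted to \<open>P\<close>, along \<open>a\<close>. It is defined on every set of
  indices because every union of fibres of \<open>a\<close> is assumed measurable.
\<close>

lemma index_measure:
  fixes N :: "'b measure" and I :: "'a set"
  assumes N: "finite_measure N" and meas: "\<And>S. {x \<in> P. a x \<in> S} \<in> sets N"
    and aI: "a ` P \<subseteq> I"
  obtains \<nu> where "finite_measure \<nu>" "space \<nu> = I" "sets \<nu> = Pow I"
    "\<And>S. S \<subseteq> I \<Longrightarrow> emeasure \<nu> S = emeasure N {x \<in> P. a x \<in> S}"
proof -
  interpret finite_measure N by fact
  have P: "P \<in> sets N" using meas[of UNIV] by simp
  then have spP: "space (restrict_space N P) = P"
    using sets.sets_into_space by (auto simp: space_restrict_space)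
  have vim: "a -` S \<inter> P = {x \<in> P. a x \<in> S}" for S by auto
  have a: "a \<in> restrict_space N P \<rightarrow>\<^sub>M count_space I"
  proof (rule measurableI)
    show "a x \<in> space (count_space I)" if "x \<in> space (restrict_space N P)" for x
      using that aI spP by auto
    show "a -` S \<inter> space (restrict_space N P) \<in> sets (restrict_space N P)" for S
      unfolding spP vim using meas[of S] P by (subst sets_restrict_space_iff) auto
  qed
  define \<nu> where "\<nu> = distr (restrict_space N P) (count_space I) a"
  have em: "emeasure \<nu> S = emeasure N {x \<in> P. a x \<in> S}" if "S \<subseteq> I" for S
  proof -
    have "emeasure \<nu> S = emeasure (restrict_space N P) {x \<in> P. a x \<in> S}"
      using that by (simp add: \<nu>_def emeasure_distr[OF a] spP vim)
    also have "\<dots> = emeasure N {x \<in> P. a x \<in> S}"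
      using P by (intro emeasure_restrict_space) auto
    finally show ?thesis .
  qed
  show thesis
  proof (rule that)
    show "finite_measure \<nu>"
      using em[of I] by (intro finite_measureI) (simp add: \<nu>_def emeasure_eq_measure)
  qed (simp_all add: \<nu>_def[symmetric] em, simp_all add: \<nu>_def)
qed

text \<open>
  This extends countable additivity to as many null pieces as an index set of measure zero allows.
\<close>

lemma null_of_measure_zero_index:
  fixes N :: "'b measure" and I :: "'a set"
  assumes N: "finite_measure N" and I: "measure_zero_cardinal (card_of I)"
    and meas: "\<And>S. {x \<in> P. a x \<in> S} \<in> sets N"
    and aI: "a ` P \<subseteq> I"
    and null: "\<And>\<alpha>. \<alpha> \<in> I \<Longrightarrow> emeasure N {x \<in> P. a x = \<alpha>} = 0"
  shows "P \<in> null_sets N"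
proof -
  obtain \<nu> where \<nu>: "finite_measure \<nu>" "space \<nu> = I" "sets \<nu> = Pow I"
    "\<And>S. S \<subseteq> I \<Longrightarrow> emeasure \<nu> S = emeasure N {x \<in> P. a x \<in> S}"
    using index_measure[OF N meas aI] by blast
  moreover have "\<forall>\<alpha>\<in>I. emeasure \<nu> {\<alpha>} = 0"
    using \<nu>(4) null by simp
  ultimately have "emeasure \<nu> I = 0"
    using I card_of_refl unfolding measure_zero_cardinal_def by blast
  moreover have "{x \<in> P. a x \<in> I} = P" using aI by auto
  ultimately show ?thesis
    using \<nu>(4)[of I] meas[of UNIV] by (auto simp: null_sets_def)
qed

text \<open>
  Each stratum \<open>P n\<close> is cut by \<open>a\<close> into pieces inside \<open>\<epsilon>\<close>-balls. Only countably many pieces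
  have positive measure, and their centres form the cover; the union of all the other pieces is
  null because the index set is uniformly discrete.
\<close>

lemma countable_ball_cover:
  fixes N :: "'a::uniform_space measure"
  assumes D: "uniform_D_space TYPE('a)" and d: "ucp d"
    and N: "finite_measure N" "sets N = sets coz_algebra" and \<epsilon>: "\<epsilon> > 0"
  obtains C where "countable C" "AE x in N. \<exists>\<alpha>\<in>C. d x \<alpha> < \<epsilon>"
proof -
  interpret finite_measure N by fact
  have pd: "pseudometric d" using d by (simp add: ucp_def)
  note dd = pseudometricD[OF pd]
  obtain r :: "'a rel" and a where
    tot: "\<And>\<alpha> \<beta>. \<alpha> \<noteq> \<beta> \<Longrightarrow> (\<alpha>, \<beta>) \<in> r \<or> (\<beta>, \<alpha>) \<in> r" and
    a: "\<And>x \<alpha>. a x = \<alpha> \<longleftrightarrow> d x \<alpha> < \<epsilon> \<and> (\<forall>\<beta>. (\<beta>, \<alpha>) \<in> r \<longrightarrow> \<epsilon> \<le> d x \<beta>)"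
    using first_centre[of d \<epsilon>] dd(2) \<epsilon> by blast
  have a1: "d x (a x) < \<epsilon>" and a2: "(\<beta>, a x) \<in> r \<Longrightarrow> \<epsilon> \<le> d x \<beta>" for x \<beta>
    using a[of x "a x"] by blast+
  define \<delta> :: "nat \<Rightarrow> real" where "\<delta> n = 1 / Suc n" for n
  have \<delta>: "\<delta> n > 0" for n by (simp add: \<delta>_def)
  define P where "P n = {x. d x (a x) \<le> \<epsilon> - \<delta> n}" for n
  have sep_centres: "\<delta> n \<le> d (a x) (a y)" if "x \<in> P n" "y \<in> P n" "a x \<noteq> a y" for n x y
  proof -
    have *: "\<delta> n \<le> d (a x) (a y)" if "x \<in> P n" "(a y, a x) \<in> r" for x y
      using a2[OF that(2)] that(1) dd(4)[of x "a y" "a x"] by (simp add: P_def)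
    show ?thesis
      using tot[OF that(3)] *[of x y] *[of y x] that dd(3)[of "a x" "a y"] by auto
  qed
  have sep: "\<delta> n \<le> d x y" if "x \<in> P n" "y \<in> P n" "a x \<noteq> a y" for n x y
  proof -
    have *: "\<delta> n \<le> d x y" if "y \<in> P n" "(a y, a x) \<in> r" for x y
      using a2[OF that(2)] that(1) dd(4)[of x "a y" y] by (simp add: P_def)
    show ?thesis
      using tot[OF that(3)] *[of x y] *[of y x] that dd(3)[of x y] by auto
  qed
  have meas: "{x \<in> P n. a x \<in> S} \<in> sets N" for n S
    unfolding N(2)
  proof (rule pseudometric_closed_measurable[OF d])
    fix x assume lim: "\<And>s. s > 0 \<Longrightarrow> \<exists>y\<in>{x \<in> P n. a x \<in> S}. d x y < s"
    from lim[of "\<delta> n / 2"] \<delta>[of n]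
    obtain y where y: "y \<in> P n" "a y \<in> S" "d x y < \<delta> n / 2" by auto
    \<comment> \<open>By separation, all points of the union close to \<open>x\<close> lie in the single piece with centre
      \<open>a y\<close>; that piece is defined by weak inequalities, which pass to the limit \<open>x\<close>.\<close>
    have near: "\<exists>z\<in>P n. a z = a y \<and> d x z < s" if s: "s > 0" for s
    proof -
      obtain z where z: "z \<in> P n" "d x z < min s (\<delta> n / 2)"
        using lim[of "min s (\<delta> n / 2)"] s \<delta>[of n] by auto
      have "d z y < \<delta> n"
        using z y(3) dd(4)[of z y x] dd(3)[of z x] by simp
      then show ?thesis
        using sep[OF z(1) y(1)] z by (intro bexI[of _ z]) auto
    qed
    have le: "d x (a y) \<le> \<epsilon> - \<delta> n"
    proof (rule field_le_epsilon)
      fix s :: real assume "s > 0"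
      from near[OF this] obtain z where "z \<in> P n" "a z = a y" "d x z < s" by auto
      then show "d x (a y) \<le> \<epsilon> - \<delta> n + s"
        using dd(4)[of x "a y" z] by (auto simp: P_def)
    qed
    moreover have "\<epsilon> \<le> d x \<beta>" if \<beta>: "(\<beta>, a y) \<in> r" for \<beta>
    proof (rule field_le_epsilon)
      fix s :: real assume "s > 0"
      from near[OF this] obtain z where z: "a z = a y" "d x z < s" by auto
      then show "\<epsilon> \<le> d x \<beta> + s"
        using a2[of \<beta> z] \<beta> dd(4)[of z \<beta> x] dd(3)[of x z] by simp
    qed
    ultimately have "a x = a y"
      using a[of x "a y"] \<delta>[of n] by auto
    then show "x \<in> {x \<in> P n. a x \<in> S}"
      using y(2) le by (simp add: P_def)
  qed
  define T where "T n = {\<alpha>. measure N {x \<in> P n. a x = \<alpha>} \<noteq> 0}" for n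
  have count: "countable (T n)" for n
  proof -
    obtain \<nu> where \<nu>: "finite_measure \<nu>"
      "\<And>S. emeasure \<nu> S = emeasure N {x \<in> P n. a x \<in> S}"
      using index_measure[OF N(1) meas[of n] subset_UNIV] by (metis subset_UNIV)
    have "measure \<nu> {\<alpha>} = measure N {x \<in> P n. a x = \<alpha>}" for \<alpha>
      using \<nu>(2)[of "{\<alpha>}"] by (simp add: measure_def)
    then show ?thesis
      using finite_measure.countable_support[OF \<nu>(1)] by (simp add: T_def)
  qed
  have null: "{x \<in> P n. a x \<notin> T n} \<in> null_sets N" for n
  proof (rule null_of_measure_zero_index[OF N(1)])
    have "uniformly_discrete (a ` P n)"
      unfolding uniformly_discrete_def uniformly_discrete_wrt_def
      using d \<delta>[of n] sep_centres[of _ n] by blast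
    then show "measure_zero_cardinal (card_of (a ` P n))"
      using D by (simp add: uniform_D_space_def)
    show "{x \<in> {x \<in> P n. a x \<notin> T n}. a x \<in> S} \<in> sets N" for S
    proof -
      have "{x \<in> {x \<in> P n. a x \<notin> T n}. a x \<in> S} = {x \<in> P n. a x \<in> S - T n}" by auto
      then show ?thesis using meas[of n "S - T n"] by simp
    qed
    show "emeasure N {x \<in> {x \<in> P n. a x \<notin> T n}. a x = \<alpha>} = 0" for \<alpha>
    proof (cases "\<alpha> \<in> T n")
      case True
      then have "{x \<in> {x \<in> P n. a x \<notin> T n}. a x = \<alpha>} = {}" by auto
      then show ?thesis by (metis emeasure_empty)
    next
      case False
      then have "{x \<in> {x \<in> P n. a x \<notin> T n}. a x = \<alpha>} = {x \<in> P n. a x = \<alpha>}" by auto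
      then show ?thesis using False by (simp add: T_def emeasure_eq_measure)
    qed
  qed auto
  show thesis
  proof (rule that)
    show "countable (\<Union>n. T n)" using count by blast
    have "AE x in N. \<forall>n. x \<notin> {x \<in> P n. a x \<notin> T n}"
      unfolding AE_all_countable using AE_not_in[OF null] by blast
    then show "AE x in N. \<exists>\<alpha>\<in>(\<Union>n. T n). d x \<alpha> < \<epsilon>"
    proof eventually_elim
      case (elim x)
      obtain n where "\<delta> n < \<epsilon> - d x (a x)"
        using nat_approx_posE[of "\<epsilon> - d x (a x)"] a1[of x] by (auto simp: \<delta>_def)
      then have "x \<in> P n" by (simp add: P_def)
      then show ?case using elim a1[of x] by blast
    qed
  qed
qed

section \<open>Integration is continuous on Lipschitz classes\<close>

text \<open>
  A neighbourhood in the pointwise topology constrains only finitely many values. It suffices to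
  constrain the centres of finitely many \<open>\<eta>\<close>-balls that leave uncovered a set \<open>U n\<close> of small
  measure.
\<close>

lemma integral_continuous_on_Lip:
  fixes N :: "'a::uniform_space measure"
  assumes D: "uniform_D_space TYPE('a)" and d: "ucp d"
    and N: "finite_measure N" "sets N = sets coz_algebra"
  shows "continuous_on (Lip d) (\<lambda>f. integral\<^sup>L N f)"
  unfolding continuous_on_def
proof (intro ballI tendstoI)
  interpret finite_measure N by fact
  have pd: "pseudometric d" using d by (simp add: ucp_def)
  note dd = pseudometricD[OF pd]
  fix f and e :: real assume f: "f \<in> Lip d" and e: "e > 0"
  \<comment> \<open>Chosen so that an error of \<open>3 * \<eta>\<close> on the whole space contributes at most \<open>e / 2\<close>; the
    added \<open>1\<close> covers a measure of total mass \<open>0\<close>.\<close>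
  define \<eta> where "\<eta> = e / (6 * (measure N (space N) + 1))"
  have \<eta>: "\<eta> > 0" using e by (simp add: \<eta>_def add_nonneg_pos)
  obtain C where C: "countable C" "AE x in N. \<exists>\<alpha>\<in>C. d x \<alpha> < \<eta>"
    using countable_ball_cover[OF D d N \<eta>] by blast
  \<comment> \<open>The extra centre only serves to enumerate a set known to be non-empty.\<close>
  define c where "c = from_nat_into (insert undefined C)"
  have c: "range c = insert undefined C"
    unfolding c_def using C(1) by (intro range_from_nat_into) auto
  define U where "U n = {x. \<forall>i\<le>n. \<eta> \<le> d x (c i)}" for n :: nat
  have U: "U n \<in> sets N" for n
    unfolding N(2)
  proof (rule pseudometric_closed_measurable[OF d])
    fix x assume lim: "\<And>s. s > 0 \<Longrightarrow> \<exists>y\<in>U n. d x y < s"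
    have "\<eta> \<le> d x (c i)" if "i \<le> n" for i
    proof (rule field_le_epsilon)
      fix s :: real assume "s > 0"
      from lim[OF this] obtain y where "y \<in> U n" "d x y < s" by blast
      then show "\<eta> \<le> d x (c i) + s"
        using that dd(4)[of y "c i" x] dd(3)[of x y] by (force simp: U_def)
    qed
    then show "x \<in> U n" by (simp add: U_def)
  qed
  have "(\<lambda>n. measure N (U n)) \<longlonglongrightarrow> measure N (\<Inter>n. U n)"
    using U by (intro finite_Lim_measure_decseq) (auto simp: decseq_def U_def)
  moreover have "measure N (\<Inter>n. U n) = 0"
  proof -
    have "AE x in N. x \<notin> (\<Inter>n. U n)"
      using C(2)
    proof eventually_elim
      case (elim x)
      then obtain \<alpha> where "\<alpha> \<in> range c" "d x \<alpha> < \<eta>" using c by blast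
      then obtain i where "d x (c i) < \<eta>" by blast
      then have "x \<notin> U i" unfolding U_def by (auto intro!: exI[of _ i])
      then show ?case by blast
    qed
    moreover have "(\<Inter>n. U n) \<in> sets N"
      using U by (intro sets.countable_INT) auto
    ultimately have "(\<Inter>n. U n) \<in> null_sets N"
      by (simp only: AE_iff_null_sets)
    then show ?thesis
      by (rule measure_eq_0_null_sets)
  qed
  ultimately have "eventually (\<lambda>n. measure N (U n) < e / 4) sequentially"
    using e by (intro order_tendstoD(2)) auto
  then obtain n where n: "measure N (U n) < e / 4"
    using eventually_happens'[OF sequentially_bot] by blast
  have "\<forall>\<^sub>F g in at f within Lip d. \<forall>i\<in>{..n}. dist (g (c i)) (f (c i)) < \<eta>"
  proof (rule eventually_ball_finite[OF finite_atMost], rule ballI)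
    fix i
    have "continuous_on UNIV (\<lambda>g::'a \<Rightarrow> real. g (c i))"
      by (rule continuous_on_product_coordinates)
    then have "((\<lambda>g. g (c i)) \<longlongrightarrow> f (c i)) (at f)"
      by (simp add: continuous_on_def)
    then have "((\<lambda>g. g (c i)) \<longlongrightarrow> f (c i)) (at f within Lip d)"
      by (rule tendsto_within_subset) simp
    then show "\<forall>\<^sub>F g in at f within Lip d. dist (g (c i)) (f (c i)) < \<eta>"
      using \<eta> by (rule tendstoD)
  qed
  moreover have "\<forall>\<^sub>F g in at f within Lip d. g \<in> Lip d"
    by (auto simp: eventually_at_filter)
  ultimately show "\<forall>\<^sub>F g in at f within Lip d. dist (integral\<^sup>L N g) (integral\<^sup>L N f) < e"
  proof eventually_elim
    case (elim g)
    have int: "integrable N f" "integrable N g"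
      using f elim(2) Lip_subset_Ub[OF d] Ub_integrable[OF _ N] by blast+
    have pt: "norm (g x - f x) \<le> 3 * \<eta> + 2 * indicator (U n) x" for x
    proof (cases "x \<in> U n")
      case True
      have "\<bar>g x\<bar> \<le> 1" "\<bar>f x\<bar> \<le> 1" using f elim(2) by (auto simp: Lip_def)
      then show ?thesis using True \<eta> by simp
    next
      case False
      then obtain i where i: "i \<le> n" "d x (c i) < \<eta>" by (auto simp: U_def not_le)
      have "\<bar>g x - g (c i)\<bar> \<le> d x (c i)" "\<bar>f x - f (c i)\<bar> \<le> d x (c i)"
        using f elim(2) by (auto simp: Lip_def)
      moreover have "\<bar>g (c i) - f (c i)\<bar> < \<eta>"
        using elim(1) i(1) by (auto simp: dist_real_def)
      ultimately show ?thesis using False i(2) by simp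
    qed
    have "dist (integral\<^sup>L N g) (integral\<^sup>L N f) = norm (integral\<^sup>L N (\<lambda>x. g x - f x))"
      using int by (simp add: dist_real_def)
    also have "\<dots> \<le> integral\<^sup>L N (\<lambda>x. norm (g x - f x))"
      by (rule integral_norm_bound)
    also have "\<dots> \<le> integral\<^sup>L N (\<lambda>x. 3 * \<eta> + 2 * indicator (U n) x)"
      using int U pt by (intro integral_mono) (auto simp: emeasure_eq_measure)
    also have "\<dots> = 3 * \<eta> * measure N (space N) + 2 * measure N (U n)"
      using U sets.sets_into_space[OF U] by (simp add: emeasure_eq_measure Int_absorb2)
    also have "\<dots> < e"
    proof -
      have "3 * \<eta> * measure N (space N) \<le> 3 * \<eta> * (measure N (space N) + 1)"
        using \<eta> by (intro mult_left_mono) auto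
      also have "\<dots> = e / 2"
      proof -
        have "measure N (space N) + 1 \<noteq> 0"
          using measure_nonneg[of N "space N"] by linarith
        then show ?thesis by (simp add: \<eta>_def field_simps)
      qed
      finally show ?thesis using n by linarith
    qed
    finally show ?case .
  qed
qed

theorem theorem2:
  "uniform_D_space TYPE('a::{uniform_space, t2_space}) \<longleftrightarrow>
    (M\<^sub>\<sigma> :: ('a ub \<Rightarrow>\<^sub>L real) set) \<subseteq> M\<^sub>u"
proof
  assume D: "uniform_D_space TYPE('a)"
  show "(M\<^sub>\<sigma> :: ('a ub \<Rightarrow>\<^sub>L real) set) \<subseteq> M\<^sub>u"
  proof
    fix \<mu> :: "'a ub \<Rightarrow>\<^sub>L real" assume "\<mu> \<in> M\<^sub>\<sigma>"
    then obtain m where m: "bounded_signed_measure coz_algebra m"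
      and \<mu>: "\<And>f. blinfun_apply \<mu> f = signed_integral coz_algebra m (apply_ub f)"
      by (auto simp: M\<^sub>\<sigma>_def)
    note m' = bounded_signed_measure_uminus[OF m]
    have "continuous_on (Lip d) (\<lambda>f. blinfun_apply \<mu> (Abs_ub f))" if d: "ucp d" for d
    proof -
      have "continuous_on (Lip d) (\<lambda>f. signed_integral coz_algebra m f)"
        unfolding signed_integral_def
        by (intro continuous_on_diff integral_continuous_on_Lip[OF D d]
            finite_measure_upper_variation sets_upper_variation m m')
      moreover have "blinfun_apply \<mu> (Abs_ub f) = signed_integral coz_algebra m f"
        if "f \<in> Lip d" for f
        using that Lip_subset_Ub[OF d] by (simp add: \<mu> Abs_ub_inverse subset_iff)
      ultimately show ?thesis
        by (simp cong: continuous_on_cong)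
    qed
    then show "\<mu> \<in> M\<^sub>u" by (simp add: M\<^sub>u_def)
  qed
next
  assume "(M\<^sub>\<sigma> :: ('a ub \<Rightarrow>\<^sub>L real) set) \<subseteq> M\<^sub>u"
  then show "uniform_D_space TYPE('a)"
    unfolding uniform_D_space_def using uniformly_discrete_measure_zero by blast
qed

end
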